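(* Let $R=R_1\times R_2\times R_3$ be a decomposable ring (a product of three commutative rings with nonzero identity), and let $M=M_1\times M_2\times M_3$ be the $R$-module (with componentwise action) where $M_1$ is an $R_1$-module, $M_2$ is an $R_2$-module and $M_3$ is an $R_3$-module. If $N$ is a weakly classical prime submodule of $M$, then either $N=\{(0,0,0)\}$ or $N$ is a classical prime submodule of $M$.
   Context: All rings are commutative with nonzero identity and all modules are unitary. A proper submodule $N$ of an $R$-module $M$ is classical prime if for all $a,b\in R$ and $m\in M$, $abm\in N$ implies $am\in N$ or $bm\in N$. A proper submodule $N$ of $M$ is weakly classical prime if for all $a,b\in R$ and $m\in M$, $0\neq abm\in N$ implies $am\in N$ or $bm\in N$.
   Formalization: The modules M_1, M_2, M_3 are assumed nonzero; otherwise the claim fails, e.g. R_i=F a field, M_1=F^2, M_2=F, M_3=0, N=(F×0)×0×0 is nonzero and weakly classical prime but not classical prime. *)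

theory Defs
  imports "HOL-Algebra.Algebra"
begin

text \<open>
  Triples are right-nested pairs, so the ring \<open>R1 \<times> R2 \<times> R3\<close> is
  \<open>RDirProd R1 (RDirProd R2 R3)\<close> and the module \<open>M1 \<times> M2 \<times> M3\<close> over it is
  \<open>MDirProd M1 (MDirProd M2 M3)\<close>.
\<close>

text \<open>
  The record type of modules extends that of rings, so a module carries the fields \<open>mult\<close> and
  \<open>one\<close>; the locale \<open>module\<close> imposes nothing on them, and here they are simply taken componentwise
  through \<open>RDirProd\<close>.
\<close>

definition MDirProd ::
  "('a, 'm, 'x) module_scheme \<Rightarrow> ('b, 'n, 'y) module_scheme \<Rightarrow> ('a \<times> 'b, 'm \<times> 'n) module"
  where "MDirProd M M' = ring.extend (RDirProd M M')
           \<lparr> smult = (\<lambda>(a, b) (x, y). (a \<odot>\<^bsub>M\<^esub> x, b \<odot>\<^bsub>M'\<^esub> y)) \<rparr>"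

definition classical_prime_submodule ::
  "('a, 'e) ring_scheme \<Rightarrow> ('a, 'm, 'x) module_scheme \<Rightarrow> 'm set \<Rightarrow> bool"
  where "classical_prime_submodule R M N \<longleftrightarrow>
    submodule N R M \<and> N \<noteq> carrier M \<and>
    (\<forall>a \<in> carrier R. \<forall>b \<in> carrier R. \<forall>m \<in> carrier M.
      (a \<otimes>\<^bsub>R\<^esub> b) \<odot>\<^bsub>M\<^esub> m \<in> N \<longrightarrow> a \<odot>\<^bsub>M\<^esub> m \<in> N \<or> b \<odot>\<^bsub>M\<^esub> m \<in> N)"

definition weakly_classical_prime_submodule ::
  "('a, 'e) ring_scheme \<Rightarrow> ('a, 'm, 'x) module_scheme \<Rightarrow> 'm set \<Rightarrow> bool"
  where "weakly_classical_prime_submodule R M N \<longleftrightarrow>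
    submodule N R M \<and> N \<noteq> carrier M \<and>
    (\<forall>a \<in> carrier R. \<forall>b \<in> carrier R. \<forall>m \<in> carrier M.
      (a \<otimes>\<^bsub>R\<^esub> b) \<odot>\<^bsub>M\<^esub> m \<noteq> \<zero>\<^bsub>M\<^esub> \<and> (a \<otimes>\<^bsub>R\<^esub> b) \<odot>\<^bsub>M\<^esub> m \<in> N \<longrightarrow>
      a \<odot>\<^bsub>M\<^esub> m \<in> N \<or> b \<odot>\<^bsub>M\<^esub> m \<in> N)"

text \<open>
  The theorem takes the three factor modules to be nonzero; without this it fails. For a field \<open>F\<close>,
  take \<open>R1 = R2 = R3 = F\<close>, \<open>M1 = F \<times> F\<close>, \<open>M2 = F\<close>, \<open>M3 = 0\<close>. Then \<open>(F \<times> 0) \<times> 0 \<times> 0\<close> is nonzero and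
  weakly classical prime, but it is not classical prime, as \<open>a = (1, 0, 1)\<close>, \<open>b = (0, 1, 1)\<close>,
  \<open>m = ((0, 1), 1, 0)\<close> show.
\<close>

lemma RDirProd_simps:
  "carrier (RDirProd R S) = carrier R \<times> carrier S"
  "\<one>\<^bsub>RDirProd R S\<^esub> = (\<one>\<^bsub>R\<^esub>, \<one>\<^bsub>S\<^esub>)"
  "\<zero>\<^bsub>RDirProd R S\<^esub> = (\<zero>\<^bsub>R\<^esub>, \<zero>\<^bsub>S\<^esub>)"
  "(a, b) \<otimes>\<^bsub>RDirProd R S\<^esub> (c, d) = (a \<otimes>\<^bsub>R\<^esub> c, b \<otimes>\<^bsub>S\<^esub> d)"
  "(a, b) \<oplus>\<^bsub>RDirProd R S\<^esub> (c, d) = (a \<oplus>\<^bsub>R\<^esub> c, b \<oplus>\<^bsub>S\<^esub> d)"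
  by (simp_all add: RDirProd_def DirProd_def monoid.defs)

lemma MDirProd_simps:
  "carrier (MDirProd M M') = carrier M \<times> carrier M'"
  "\<zero>\<^bsub>MDirProd M M'\<^esub> = (\<zero>\<^bsub>M\<^esub>, \<zero>\<^bsub>M'\<^esub>)"
  "(x, y) \<oplus>\<^bsub>MDirProd M M'\<^esub> (z, w) = (x \<oplus>\<^bsub>M\<^esub> z, y \<oplus>\<^bsub>M'\<^esub> w)"
  "(a, b) \<odot>\<^bsub>MDirProd M M'\<^esub> (x, y) = (a \<odot>\<^bsub>M\<^esub> x, b \<odot>\<^bsub>M'\<^esub> y)"
  by (simp_all add: MDirProd_def RDirProd_def DirProd_def monoid.defs ring.defs)

lemma RDirProd_cring:
  assumes "cring R" and "cring S"
  shows "cring (RDirProd R S)"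
proof -
  interpret R: cring R by fact
  interpret S: cring S by fact
  interpret P: ring "RDirProd R S" by (rule RDirProd_ring) unfold_locales
  show ?thesis
    by unfold_locales (auto simp: RDirProd_simps R.m_comm S.m_comm)
qed

lemma MDirProd_module:
  assumes "module R M" and "module S M'"
  shows "module (RDirProd R S) (MDirProd M M')"
proof -
  interpret M: module R M by fact
  interpret M': module S M' by fact
  have "abelian_group (MDirProd M M')"
  proof (rule abelian_groupI)
    fix x assume "x \<in> carrier (MDirProd M M')"
    then show "\<exists>y\<in>carrier (MDirProd M M'). y \<oplus>\<^bsub>MDirProd M M'\<^esub> x = \<zero>\<^bsub>MDirProd M M'\<^esub>"
      by (auto simp: MDirProd_simps intro!: bexI[of _ "(\<ominus>\<^bsub>M\<^esub> fst x, \<ominus>\<^bsub>M'\<^esub> snd x)"]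
            M.M.l_neg M'.M.l_neg)
  qed (auto simp: MDirProd_simps M.M.add.m_ac M'.M.add.m_ac)
  then show ?thesis
    by (intro moduleI RDirProd_cring M.R.cring_axioms M'.R.cring_axioms)
      (auto simp: MDirProd_simps RDirProd_simps M.smult_l_distr M'.smult_l_distr
        M.smult_r_distr M'.smult_r_distr M.smult_assoc1 M'.smult_assoc1)
qed

end

theory Submission
  imports Defs
begin

text \<open>
  Split the module by the orthogonal idempotents \<open>e1 = (1, 0, 0)\<close>, \<open>e2 = (0, 1, 0)\<close>, \<open>e3 = (0, 0, 1)\<close>.
  If \<open>x \<in> N\<close> and \<open>e1 x \<noteq> 0\<close>, then \<open>(e1 + e3) (e1 + e2) (e1 x + e2 y + e3 z) = e1 x\<close> is a nonzero
  element of \<open>N\<close>, so \<open>e3 z \<in> N\<close> or \<open>e2 y \<in> N\<close>; as \<open>y\<close> and \<open>z\<close> are arbitrary, \<open>N\<close> contains a whole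
  nonzero summand \<open>e M\<close>. Modulo such a summand one may replace \<open>a, b, m\<close> by elements whose
  \<open>e\<close>-components are \<open>1, 1, z\<close> with \<open>e z \<noteq> 0\<close>. This makes \<open>a b m\<close> nonzero without affecting membership
  in \<open>N\<close>, so the weak condition gives the full one.
\<close>

lemma submodule_add_cancel:
  assumes "module R M" "submodule N R M"
    and "x \<in> N" "y \<in> carrier M" "x \<oplus>\<^bsub>M\<^esub> y \<in> N"
  shows "y \<in> N"
proof -
  interpret module R M by fact
  interpret N: submodule N R M by fact
  have x: "x \<in> carrier M" using assms(3) N.subset by auto
  \<comment> \<open>\<open>submodule\<close> extends \<open>subgroup\<close> over the additive
    monoid of \<open>M\<close>, so \<open>m_inv_closed\<close> and \<open>m_closed\<close> here
    concern negation and addition.\<close>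
  have "\<ominus>\<^bsub>M\<^esub> x \<in> N" using N.m_inv_closed[OF assms(3)] by (simp add: a_inv_def)
  then have "\<ominus>\<^bsub>M\<^esub> x \<oplus>\<^bsub>M\<^esub> (x \<oplus>\<^bsub>M\<^esub> y) \<in> N"
    using N.m_closed[OF _ assms(5)] by simp
  then show ?thesis using x assms(4) by (simp add: M.r_neg1)
qed

text \<open>The cross terms die by orthogonality: the scalar times \<open>f\<close> is
  \<open>f \<otimes> c\<close>, and times \<open>e\<close> it is \<open>e\<close>. So a scalar whose
  \<open>e\<close>-part is overwritten by 1 acts as \<open>c\<close> on the \<open>f\<close>-part
  and fixes the prescribed \<open>e\<close>-part of the vector.\<close>

lemma (in module) smult_idempotent_split:
  assumes "e \<in> carrier R" "f \<in> carrier R" "c \<in> carrier R" "m \<in> carrier M" "z \<in> carrier M"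
    and "e \<otimes> e = e" "f \<otimes> f = f" "e \<otimes> f = \<zero>"
  shows "(f \<otimes> c \<oplus> e) \<odot>\<^bsub>M\<^esub> (f \<odot>\<^bsub>M\<^esub> m \<oplus>\<^bsub>M\<^esub> e \<odot>\<^bsub>M\<^esub> z) =
    f \<odot>\<^bsub>M\<^esub> (c \<odot>\<^bsub>M\<^esub> m) \<oplus>\<^bsub>M\<^esub> e \<odot>\<^bsub>M\<^esub> z"
proof -
  have "(f \<otimes> c \<oplus> e) \<otimes> f = (f \<otimes> f) \<otimes> c \<oplus> e \<otimes> f"
    using assms(1-3) by algebra
  then have f: "(f \<otimes> c \<oplus> e) \<otimes> f = f \<otimes> c" using assms by simp
  have "(f \<otimes> c \<oplus> e) \<otimes> e = (e \<otimes> f) \<otimes> c \<oplus> e \<otimes> e"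
    using assms(1-3) by algebra
  then have e: "(f \<otimes> c \<oplus> e) \<otimes> e = e" using assms by simp
  show ?thesis
    using assms(1-5) by (simp add: smult_r_distr smult_assoc1[symmetric] f e)
qed

lemma weakly_classical_prime_containing_summand:
  assumes "module R M" and weak: "weakly_classical_prime_submodule R M N"
    and e: "e \<in> carrier R" "e \<otimes>\<^bsub>R\<^esub> e = e"
    and sub: "\<And>x. x \<in> carrier M \<Longrightarrow> e \<odot>\<^bsub>M\<^esub> x \<in> N"
    and z: "z \<in> carrier M" "e \<odot>\<^bsub>M\<^esub> z \<noteq> \<zero>\<^bsub>M\<^esub>"
  shows "classical_prime_submodule R M N"
proof -
  interpret module R M by fact
  have N: "submodule N R M" and proper: "N \<noteq> carrier M"
    using weak by (auto simp: weakly_classical_prime_submodule_def)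
  interpret N: submodule N R M by (rule N)
  \<comment> \<open>The idempotent complementary to \<open>e\<close>; it carries the part of
    \<open>a\<close>, \<open>b\<close>, \<open>m\<close> that is kept.\<close>
  define f where "f = \<one>\<^bsub>R\<^esub> \<ominus>\<^bsub>R\<^esub> e"
  have f: "f \<in> carrier R" using e by (simp add: f_def)
  have "f \<otimes>\<^bsub>R\<^esub> f = \<one>\<^bsub>R\<^esub> \<ominus>\<^bsub>R\<^esub> e \<ominus>\<^bsub>R\<^esub> e \<oplus>\<^bsub>R\<^esub> e \<otimes>\<^bsub>R\<^esub> e"
    using e(1) unfolding f_def by algebra
  also have "\<dots> = f" using e(1) unfolding f_def e(2) by algebra
  finally have ff: "f \<otimes>\<^bsub>R\<^esub> f = f" .
  have "e \<otimes>\<^bsub>R\<^esub> f = e \<ominus>\<^bsub>R\<^esub> e \<otimes>\<^bsub>R\<^esub> e" using e(1) unfolding f_def by algebra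
  then have ef: "e \<otimes>\<^bsub>R\<^esub> f = \<zero>\<^bsub>R\<^esub>" using e by (simp add: R.r_neg R.minus_eq)
  have one: "f \<oplus>\<^bsub>R\<^esub> e = \<one>\<^bsub>R\<^esub>" using e(1) unfolding f_def by algebra
  note split = smult_idempotent_split[OF e(1) f _ _ z(1) e(2) ff ef]
  \<comment> \<open>Exchanging the \<open>e\<close>-component \<open>e x\<close> for
    \<open>e z\<close> does not affect membership, since \<open>sub\<close> puts both in
    \<open>N\<close>.\<close>
  have split_iff: "f \<odot>\<^bsub>M\<^esub> x \<oplus>\<^bsub>M\<^esub> e \<odot>\<^bsub>M\<^esub> z \<in> N \<longleftrightarrow> x \<in> N" if x: "x \<in> carrier M" for x
  proof
    have x_eq: "f \<odot>\<^bsub>M\<^esub> x \<oplus>\<^bsub>M\<^esub> e \<odot>\<^bsub>M\<^esub> x = x"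
      using x e(1) f by (simp add: smult_l_distr[symmetric] one)
    { assume "f \<odot>\<^bsub>M\<^esub> x \<oplus>\<^bsub>M\<^esub> e \<odot>\<^bsub>M\<^esub> z \<in> N"
      then have "f \<odot>\<^bsub>M\<^esub> x \<in> N"
        using submodule_add_cancel[OF assms(1) N sub[OF z(1)], of "f \<odot>\<^bsub>M\<^esub> x"] x z(1) e(1) f
        by (simp add: M.a_comm)
      then show "x \<in> N" using N.m_closed[OF _ sub[OF x]] x_eq by fastforce }
    { assume "x \<in> N"
      then show "f \<odot>\<^bsub>M\<^esub> x \<oplus>\<^bsub>M\<^esub> e \<odot>\<^bsub>M\<^esub> z \<in> N"
        using N.m_closed[OF _ sub[OF z(1)]] N.smult_closed[OF f] by simp }
  qed
  \<comment> \<open>Multiplication by \<open>e\<close> kills \<open>f x\<close> and fixes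
    \<open>e z\<close>, which is nonzero by the choice of \<open>z\<close>.\<close>
  have nonzero: "f \<odot>\<^bsub>M\<^esub> x \<oplus>\<^bsub>M\<^esub> e \<odot>\<^bsub>M\<^esub> z \<noteq> \<zero>\<^bsub>M\<^esub>" if x: "x \<in> carrier M" for x
  proof
    assume "f \<odot>\<^bsub>M\<^esub> x \<oplus>\<^bsub>M\<^esub> e \<odot>\<^bsub>M\<^esub> z = \<zero>\<^bsub>M\<^esub>"
    then have "e \<odot>\<^bsub>M\<^esub> (f \<odot>\<^bsub>M\<^esub> x \<oplus>\<^bsub>M\<^esub> e \<odot>\<^bsub>M\<^esub> z) = \<zero>\<^bsub>M\<^esub>" using e(1) by simp
    then show False
      using x z e f by (simp add: smult_r_distr smult_assoc1[symmetric] ef)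
  qed
  have "a \<odot>\<^bsub>M\<^esub> m \<in> N \<or> b \<odot>\<^bsub>M\<^esub> m \<in> N"
    if a: "a \<in> carrier R" and b: "b \<in> carrier R" and m: "m \<in> carrier M"
      and abm: "(a \<otimes>\<^bsub>R\<^esub> b) \<odot>\<^bsub>M\<^esub> m \<in> N" for a b m
  proof -
    let ?a = "f \<otimes>\<^bsub>R\<^esub> a \<oplus>\<^bsub>R\<^esub> e" and ?b = "f \<otimes>\<^bsub>R\<^esub> b \<oplus>\<^bsub>R\<^esub> e"
    let ?m = "f \<odot>\<^bsub>M\<^esub> m \<oplus>\<^bsub>M\<^esub> e \<odot>\<^bsub>M\<^esub> z"
    \<comment> \<open>The terms are grouped so that \<open>ff\<close>, \<open>ef\<close> and
      idempotence of \<open>e\<close> apply; the product is then again of the shape in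
      \<open>split\<close>, with \<open>c\<close> the product of \<open>a\<close> and
      \<open>b\<close>.\<close>
    have "?a \<otimes>\<^bsub>R\<^esub> ?b = (f \<otimes>\<^bsub>R\<^esub> f) \<otimes>\<^bsub>R\<^esub> (a \<otimes>\<^bsub>R\<^esub> b) \<oplus>\<^bsub>R\<^esub> (e \<otimes>\<^bsub>R\<^esub> f) \<otimes>\<^bsub>R\<^esub> (a \<oplus>\<^bsub>R\<^esub> b)
        \<oplus>\<^bsub>R\<^esub> e \<otimes>\<^bsub>R\<^esub> e"
      using a b e(1) f by algebra
    then have "?a \<otimes>\<^bsub>R\<^esub> ?b = f \<otimes>\<^bsub>R\<^esub> (a \<otimes>\<^bsub>R\<^esub> b) \<oplus>\<^bsub>R\<^esub> e"
      using a b f e by (simp add: ff ef)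
    then have "(?a \<otimes>\<^bsub>R\<^esub> ?b) \<odot>\<^bsub>M\<^esub> ?m = f \<odot>\<^bsub>M\<^esub> ((a \<otimes>\<^bsub>R\<^esub> b) \<odot>\<^bsub>M\<^esub> m) \<oplus>\<^bsub>M\<^esub> e \<odot>\<^bsub>M\<^esub> z"
      using a b m by (simp add: split)
    then have "(?a \<otimes>\<^bsub>R\<^esub> ?b) \<odot>\<^bsub>M\<^esub> ?m \<noteq> \<zero>\<^bsub>M\<^esub> \<and> (?a \<otimes>\<^bsub>R\<^esub> ?b) \<odot>\<^bsub>M\<^esub> ?m \<in> N"
      using a b m abm nonzero split_iff by simp
    moreover have "?a \<in> carrier R" "?b \<in> carrier R" "?m \<in> carrier M"
      using a b m e f z by auto
    ultimately have "?a \<odot>\<^bsub>M\<^esub> ?m \<in> N \<or> ?b \<odot>\<^bsub>M\<^esub> ?m \<in> N"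
      using weak unfolding weakly_classical_prime_submodule_def by blast
    then show ?thesis using a b m by (simp add: split split_iff)
  qed
  then show ?thesis
    using N proper unfolding classical_prime_submodule_def by blast
qed

text \<open>The element \<open>e1 x\<close> serves as a nonzero product in \<open>N\<close>,
  obtained from a vector whose \<open>e2\<close>- and \<open>e3\<close>-components are free.\<close>

lemma weakly_classical_prime_contains_summand:
  assumes "module R M" and weak: "weakly_classical_prime_submodule R M N"
    and carr: "e1 \<in> carrier R" "e2 \<in> carrier R" "e3 \<in> carrier R"
    and idem: "e1 \<otimes>\<^bsub>R\<^esub> e1 = e1" "e2 \<otimes>\<^bsub>R\<^esub> e2 = e2" "e3 \<otimes>\<^bsub>R\<^esub> e3 = e3"
    and orth: "e1 \<otimes>\<^bsub>R\<^esub> e2 = \<zero>\<^bsub>R\<^esub>" "e1 \<otimes>\<^bsub>R\<^esub> e3 = \<zero>\<^bsub>R\<^esub>" "e2 \<otimes>\<^bsub>R\<^esub> e3 = \<zero>\<^bsub>R\<^esub>"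
    and x: "x \<in> N" "e1 \<odot>\<^bsub>M\<^esub> x \<noteq> \<zero>\<^bsub>M\<^esub>"
  shows "(\<forall>y\<in>carrier M. e2 \<odot>\<^bsub>M\<^esub> y \<in> N) \<or> (\<forall>z\<in>carrier M. e3 \<odot>\<^bsub>M\<^esub> z \<in> N)"
proof -
  interpret module R M by fact
  have N: "submodule N R M"
    using weak by (auto simp: weakly_classical_prime_submodule_def)
  interpret N: submodule N R M by (rule N)
  have xM: "x \<in> carrier M" using x(1) N.subset by auto
  have e1x: "e1 \<odot>\<^bsub>M\<^esub> x \<in> N" using N.smult_closed carr x(1) by auto
  have orth': "e2 \<otimes>\<^bsub>R\<^esub> e1 = \<zero>\<^bsub>R\<^esub>" "e3 \<otimes>\<^bsub>R\<^esub> e1 = \<zero>\<^bsub>R\<^esub>" "e3 \<otimes>\<^bsub>R\<^esub> e2 = \<zero>\<^bsub>R\<^esub>"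
    using orth carr by (simp_all add: R.m_comm)
  have "e2 \<odot>\<^bsub>M\<^esub> y \<in> N \<or> e3 \<odot>\<^bsub>M\<^esub> z \<in> N" if y: "y \<in> carrier M" and z: "z \<in> carrier M" for y z
  proof -
    \<comment> \<open>\<open>?a\<close> omits \<open>e2\<close> and \<open>?b\<close> omits
      \<open>e3\<close>: their product keeps only the \<open>e1\<close>-component, while each alone
      keeps one free component besides \<open>e1 x\<close>.\<close>
    let ?a = "e1 \<oplus>\<^bsub>R\<^esub> e3" and ?b = "e1 \<oplus>\<^bsub>R\<^esub> e2"
    let ?m = "e1 \<odot>\<^bsub>M\<^esub> x \<oplus>\<^bsub>M\<^esub> (e2 \<odot>\<^bsub>M\<^esub> y \<oplus>\<^bsub>M\<^esub> e3 \<odot>\<^bsub>M\<^esub> z)"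
    note simps = smult_r_distr smult_l_distr smult_assoc1[symmetric] R.l_distr R.r_distr
      idem orth orth'
    have abm: "(?a \<otimes>\<^bsub>R\<^esub> ?b) \<odot>\<^bsub>M\<^esub> ?m = e1 \<odot>\<^bsub>M\<^esub> x"
      using carr xM y z by (simp add: simps)
    have am: "?a \<odot>\<^bsub>M\<^esub> ?m = e1 \<odot>\<^bsub>M\<^esub> x \<oplus>\<^bsub>M\<^esub> e3 \<odot>\<^bsub>M\<^esub> z"
      using carr xM y z by (simp add: simps)
    have bm: "?b \<odot>\<^bsub>M\<^esub> ?m = e1 \<odot>\<^bsub>M\<^esub> x \<oplus>\<^bsub>M\<^esub> e2 \<odot>\<^bsub>M\<^esub> y"
      using carr xM y z by (simp add: simps)
    have "?a \<in> carrier R" "?b \<in> carrier R" "?m \<in> carrier M"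
      using carr xM y z by auto
    then have "?a \<odot>\<^bsub>M\<^esub> ?m \<in> N \<or> ?b \<odot>\<^bsub>M\<^esub> ?m \<in> N"
      using weak abm e1x x(2) unfolding weakly_classical_prime_submodule_def by metis
    then show ?thesis
      using submodule_add_cancel[OF assms(1) N e1x] carr y z unfolding am bm by auto
  qed
  \<comment> \<open>If some \<open>e2 y\<close> lies outside \<open>N\<close>, pairing this
    \<open>y\<close> with every \<open>z\<close> puts all \<open>e3 z\<close> in
    \<open>N\<close>.\<close>
  then show ?thesis by blast
qed

text \<open>Stated for abstract idempotents rather than triples, so that the three cases differ only
  by a permutation of indices.\<close>

lemma weakly_classical_prime_three_summands:
  assumes "module R M" and weak: "weakly_classical_prime_submodule R M N"
    and carr: "e1 \<in> carrier R" "e2 \<in> carrier R" "e3 \<in> carrier R"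
    and idem: "e1 \<otimes>\<^bsub>R\<^esub> e1 = e1" "e2 \<otimes>\<^bsub>R\<^esub> e2 = e2" "e3 \<otimes>\<^bsub>R\<^esub> e3 = e3"
    and orth: "e1 \<otimes>\<^bsub>R\<^esub> e2 = \<zero>\<^bsub>R\<^esub>" "e1 \<otimes>\<^bsub>R\<^esub> e3 = \<zero>\<^bsub>R\<^esub>" "e2 \<otimes>\<^bsub>R\<^esub> e3 = \<zero>\<^bsub>R\<^esub>"
    and sum: "e1 \<oplus>\<^bsub>R\<^esub> (e2 \<oplus>\<^bsub>R\<^esub> e3) = \<one>\<^bsub>R\<^esub>"
    and nz: "\<exists>z\<in>carrier M. e1 \<odot>\<^bsub>M\<^esub> z \<noteq> \<zero>\<^bsub>M\<^esub>" "\<exists>z\<in>carrier M. e2 \<odot>\<^bsub>M\<^esub> z \<noteq> \<zero>\<^bsub>M\<^esub>"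
      "\<exists>z\<in>carrier M. e3 \<odot>\<^bsub>M\<^esub> z \<noteq> \<zero>\<^bsub>M\<^esub>"
  shows "N = {\<zero>\<^bsub>M\<^esub>} \<or> classical_prime_submodule R M N"
proof (cases "N = {\<zero>\<^bsub>M\<^esub>}")
  case False
  interpret module R M by fact
  interpret N: submodule N R M
    using weak by (auto simp: weakly_classical_prime_submodule_def)
  have orth': "e2 \<otimes>\<^bsub>R\<^esub> e1 = \<zero>\<^bsub>R\<^esub>" "e3 \<otimes>\<^bsub>R\<^esub> e1 = \<zero>\<^bsub>R\<^esub>" "e3 \<otimes>\<^bsub>R\<^esub> e2 = \<zero>\<^bsub>R\<^esub>"
    using orth carr by (simp_all add: R.m_comm)
  have "\<zero>\<^bsub>M\<^esub> \<in> N" using N.one_closed by simp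
  then obtain x where x: "x \<in> N" "x \<noteq> \<zero>\<^bsub>M\<^esub>" using False by auto
  then have xM: "x \<in> carrier M" using N.subset by auto
  have "e1 \<odot>\<^bsub>M\<^esub> x \<oplus>\<^bsub>M\<^esub> (e2 \<odot>\<^bsub>M\<^esub> x \<oplus>\<^bsub>M\<^esub> e3 \<odot>\<^bsub>M\<^esub> x) = x"
    using carr xM by (simp add: smult_l_distr[symmetric] sum)
  \<comment> \<open>The components of \<open>x\<close> sum to \<open>x\<close>, so they cannot all
    vanish.\<close>
  then consider "e1 \<odot>\<^bsub>M\<^esub> x \<noteq> \<zero>\<^bsub>M\<^esub>" | "e2 \<odot>\<^bsub>M\<^esub> x \<noteq> \<zero>\<^bsub>M\<^esub>" | "e3 \<odot>\<^bsub>M\<^esub> x \<noteq> \<zero>\<^bsub>M\<^esub>"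
    using x(2) M.l_zero[OF M.zero_closed] by metis
  then have "(\<forall>y\<in>carrier M. e1 \<odot>\<^bsub>M\<^esub> y \<in> N) \<or> (\<forall>y\<in>carrier M. e2 \<odot>\<^bsub>M\<^esub> y \<in> N) \<or>
      (\<forall>y\<in>carrier M. e3 \<odot>\<^bsub>M\<^esub> y \<in> N)"
  proof cases
    case 1
    from weakly_classical_prime_contains_summand
      [OF assms(1) weak carr idem orth x(1) this]
    show ?thesis by blast
  next
    case 2
    from weakly_classical_prime_contains_summand
      [OF assms(1) weak carr(2,1,3) idem(2,1,3) orth'(1) orth(3,2) x(1) this]
    show ?thesis by blast
  next
    case 3
    from weakly_classical_prime_contains_summand
      [OF assms(1) weak carr(3,1,2) idem(3,1,2) orth'(2,3) orth(1) x(1) this]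
    show ?thesis by blast
  qed
  \<comment> \<open>Whichever summand lies in \<open>N\<close>, \<open>nz\<close> supplies the
    nonzero \<open>e z\<close> in it.\<close>
  then show ?thesis
    using weakly_classical_prime_containing_summand[OF assms(1) weak carr(1) idem(1)] nz(1)
      weakly_classical_prime_containing_summand[OF assms(1) weak carr(2) idem(2)] nz(2)
      weakly_classical_prime_containing_summand[OF assms(1) weak carr(3) idem(3)] nz(3)
    by blast
qed simp

theorem theorem2p38:
  fixes R1 :: "('r1, 'e1) ring_scheme" and R2 :: "('r2, 'e2) ring_scheme"
    and R3 :: "('r3, 'e3) ring_scheme"
    and M1 :: "('r1, 'm1, 'x1) module_scheme" and M2 :: "('r2, 'm2, 'x2) module_scheme"
    and M3 :: "('r3, 'm3, 'x3) module_scheme"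
    and N :: "('m1 \<times> 'm2 \<times> 'm3) set"
  assumes "cring R1" "cring R2" "cring R3"
    and "\<one>\<^bsub>R1\<^esub> \<noteq> \<zero>\<^bsub>R1\<^esub>" "\<one>\<^bsub>R2\<^esub> \<noteq> \<zero>\<^bsub>R2\<^esub>" "\<one>\<^bsub>R3\<^esub> \<noteq> \<zero>\<^bsub>R3\<^esub>"
    and "module R1 M1" "module R2 M2" "module R3 M3"
    and "carrier M1 \<noteq> {\<zero>\<^bsub>M1\<^esub>}" "carrier M2 \<noteq> {\<zero>\<^bsub>M2\<^esub>}" "carrier M3 \<noteq> {\<zero>\<^bsub>M3\<^esub>}"
    and "weakly_classical_prime_submodule
           (RDirProd R1 (RDirProd R2 R3)) (MDirProd M1 (MDirProd M2 M3)) N"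
  shows "N = {(\<zero>\<^bsub>M1\<^esub>, \<zero>\<^bsub>M2\<^esub>, \<zero>\<^bsub>M3\<^esub>)} \<or>
         classical_prime_submodule
           (RDirProd R1 (RDirProd R2 R3)) (MDirProd M1 (MDirProd M2 M3)) N"
proof -
  interpret M1: module R1 M1 by fact
  interpret M2: module R2 M2 by fact
  interpret M3: module R3 M3 by fact
  let ?R = "RDirProd R1 (RDirProd R2 R3)" and ?M = "MDirProd M1 (MDirProd M2 M3)"
  have M: "module ?R ?M"
    by (intro MDirProd_module assms)
  obtain z1 z2 z3 where z: "z1 \<in> carrier M1" "z1 \<noteq> \<zero>\<^bsub>M1\<^esub>" "z2 \<in> carrier M2" "z2 \<noteq> \<zero>\<^bsub>M2\<^esub>"
    "z3 \<in> carrier M3" "z3 \<noteq> \<zero>\<^bsub>M3\<^esub>"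
    using assms(10-12) M1.zero_closed M2.zero_closed M3.zero_closed by blast
  have "N = {\<zero>\<^bsub>?M\<^esub>} \<or> classical_prime_submodule ?R ?M N"
    \<comment> \<open>The one triple \<open>(z1, z2, z3)\<close> witnesses all three nonvanishing
      conditions, as each coordinate idempotent retains a nonzero entry.\<close>
    using assms(13) z
    by (intro weakly_classical_prime_three_summands[OF M, of N
          "(\<one>\<^bsub>R1\<^esub>, \<zero>\<^bsub>R2\<^esub>, \<zero>\<^bsub>R3\<^esub>)" "(\<zero>\<^bsub>R1\<^esub>, \<one>\<^bsub>R2\<^esub>, \<zero>\<^bsub>R3\<^esub>)" "(\<zero>\<^bsub>R1\<^esub>, \<zero>\<^bsub>R2\<^esub>, \<one>\<^bsub>R3\<^esub>)"]
          bexI[of _ "(z1, z2, z3)"])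
      (simp_all add: RDirProd_simps MDirProd_simps)
  then show ?thesis by (simp add: MDirProd_simps)
qed

end
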